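(* Let $R:[0,\infty)\to SO(3)$ and $\Omega:[0,\infty)\to\mathbb R^3$ satisfy the rigid body kinematic equation $\dot R = R\hat\Omega$, and assume that $\Omega$ is bounded on $[0,\infty)$. Let $b\in\mathbb R^3$ be a constant vector and set $\Omega_{\rm m}(t)=\Omega(t)+b$. Let $F\in\mathbb R^{3\times 3}$ be a constant invertible matrix and set $A(t)=F R(t)$. Let $k_P>0$ and $k_I>0$. Then there exist numbers $a>0$ and $C>0$ such that for every $(\bar A(0),\bar b(0))\in\mathbb R^{3\times 3}\times\mathbb R^3$, the solution $(\bar A(t),\bar b(t))\in\mathbb R^{3\times 3}\times\mathbb R^3$ of $$\dot{\bar A} = \bar A\,\hat\Omega_{\rm m} - A\,\hat{\bar b} + k_P(A-\bar A),\qquad \dot{\bar b} = k_I\,\mathrm{Skew}(A^T\bar A)^\vee$$ with this initial condition satisfies, with $E_R = R-F^{-1}\bar A$ and $e_b=b-\bar b$, $$\|E_R(t)\|+\|e_b(t)\|\le C\,\big(\|E_R(0)\|+\|e_b(0)\|\big)\,e^{-at}\qquad\text{for all } t\ge 0.$$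
   Context: $SO(3)=\{R\in\mathbb R^{3\times3}\mid R^TR=I,\ \det R=1\}$ and $\mathfrak{so}(3)=\{M\in\mathbb R^{3\times 3}\mid M^T+M=0\}$. The hat map $\wedge:\mathbb R^3\to\mathfrak{so}(3)$ is $$\hat x=\begin{bmatrix}0&-x_3&x_2\\ x_3&0&-x_1\\ -x_2&x_1&0\end{bmatrix},\quad x=(x_1,x_2,x_3),$$ and the vee map $\vee:\mathfrak{so}(3)\to\mathbb R^3$ is its inverse. For a square matrix $M$, $\mathrm{Skew}(M)=\tfrac12(M-M^T)$. The norm $\|\cdot\|$ is the Euclidean norm on vectors and the Frobenius norm on matrices, i.e. the norm induced by $\langle M,N\rangle=\operatorname{tr}(M^TN)$. A dot denotes the time derivative. The constants $a$ and $C$ do not depend on $t$ or on the observer's initial condition $(\bar A(0),\bar b(0))$. *)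

theory Defs
  imports "HOL-Analysis.Analysis"
begin

definition SO3 :: "(real^3^3) set" where
  "SO3 = {R. transpose R ** R = mat 1 \<and> det R = 1}"

definition so3 :: "(real^3^3) set" where
  "so3 = {M. transpose M + M = 0}"

definition hat :: "real^3 \<Rightarrow> real^3^3" where
  "hat x = vector [vector [0, - x$3, x$2],
                   vector [x$3, 0, - x$1],
                   vector [- x$2, x$1, 0]]"

text \<open>The vee map is the inverse of the hat map; its value is meaningful only on \<open>so3\<close>,
  where \<open>hat_vee\<close> below applies.\<close>

definition vee :: "real^3^3 \<Rightarrow> real^3" where
  "vee = inv hat"

definition Skew :: "real^'n^'n \<Rightarrow> real^'n^'n" where
  "Skew M = (1/2) *\<^sub>R (M - transpose M)"

lemma inj_hat: "inj hat"
  unfolding inj_def hat_def by (simp add: vec_eq_iff forall_3)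

lemma range_hat: "range hat = so3"
proof
  show "range hat \<subseteq> so3"
    by (auto simp: so3_def hat_def vec_eq_iff forall_3 transpose_def)
  show "so3 \<subseteq> range hat"
  proof
    fix M :: "real^3^3" assume "M \<in> so3"
    then have "M = hat (vector [M$3$2, M$1$3, M$2$1])"
      by (auto simp: so3_def hat_def vec_eq_iff forall_3 transpose_def)
    then show "M \<in> range hat" by blast
  qed
qed

lemma bij_betw_hat: "bij_betw hat UNIV so3"
  using inj_hat range_hat by (simp add: bij_betw_def)

lemma vee_hat: "vee (hat x) = x"
  by (simp add: vee_def inj_hat)

lemma hat_vee: "M \<in> so3 \<Longrightarrow> hat (vee M) = M"
  by (simp add: vee_def f_inv_into_f range_hat)

lemma Skew_in_so3: "Skew M \<in> so3"
  by (simp add: so3_def Skew_def vec_eq_iff transpose_def field_simps)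

text \<open>The library's inner product and norm on \<open>real^'n^'m\<close> are the Frobenius ones.\<close>

lemma inner_matrix_eq_trace: "M \<bullet> N = trace (transpose M ** N)" for M N :: "real^'n^'m"
  unfolding trace_def transpose_def matrix_matrix_mult_def inner_vec_def
  by (simp add: sum.swap[of _ "UNIV :: 'm set"])

lemma norm_matrix_eq_frobenius: "norm M = sqrt (trace (transpose M ** M))" for M :: "real^'n^'m"
  by (simp add: norm_eq_sqrt_inner inner_matrix_eq_trace)

end

theory Submission
  imports Defs
begin

text \<open>With \<open>E = R - F\<^sup>-\<^sup>1 Abar\<close> and \<open>e = b - bbar\<close> the error satisfies the linear system
  \<open>E' = E hat \<Omega>\<^sub>m - R hat e - k\<^sub>P E\<close>, \<open>e' = k\<^sub>I vee (Skew (R\<^sup>T F\<^sup>T F E))\<close>. The energy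
  \<open>\<parallel>F E\<parallel>\<^sup>2 / 2 + \<parallel>e\<parallel>\<^sup>2 / k\<^sub>I\<close> has derivative \<open>- k\<^sub>P \<parallel>F E\<parallel>\<^sup>2\<close>, which controls only \<open>E\<close>. Adding the
  small cross term \<open>\<epsilon> (E \<bullet> R hat e)\<close>, whose derivative contains \<open>- \<epsilon> \<parallel>R hat e\<parallel>\<^sup>2 = - 2 \<epsilon> \<parallel>e\<parallel>\<^sup>2\<close>,
  yields a quadratic Lyapunov function \<open>V\<close> with \<open>V' \<le> - c V\<close>.\<close>

section \<open>Adjoints of matrix multiplication for the Frobenius inner product\<close>

lemma inner_matrix_mult_left:
  fixes M :: "real^'n^'m" and P :: "real^'m^'k"
  shows "(P ** M) \<bullet> N = M \<bullet> (transpose P ** N)"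
  by (simp add: inner_matrix_eq_trace matrix_transpose_mul matrix_mul_assoc)

lemma inner_matrix_mult_right:
  fixes M :: "real^'n^'m" and P :: "real^'k^'n"
  shows "(M ** P) \<bullet> N = M \<bullet> (N ** transpose P)"
proof -
  have "(M ** P) \<bullet> N = trace (transpose P ** (transpose M ** N))"
    by (simp add: inner_matrix_eq_trace matrix_transpose_mul matrix_mul_assoc)
  also have "\<dots> = trace ((transpose M ** N) ** transpose P)"
    by (rule trace_mul_sym)
  finally show ?thesis
    by (simp add: inner_matrix_eq_trace matrix_mul_assoc)
qed

lemma norm_orthogonal_mult:
  fixes M :: "real^'n^'m" and Q :: "real^'m^'m"
  assumes "transpose Q ** Q = mat 1"
  shows "norm (Q ** M) = norm M"
  by (simp add: norm_eq_sqrt_inner inner_matrix_mult_left matrix_mul_assoc assms)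

text \<open>Supplies the product rule for derivatives, linearity in each factor, and a constant
  bounding the norm of a product.\<close>

lemma bounded_bilinear_matrix_mult:
  "bounded_bilinear ((**) :: real^'n^'m \<Rightarrow> real^'k^'n \<Rightarrow> real^'k^'m)"
  by (simp add: bilinear_conv_bounded_bilinear[symmetric] bilinear_def linear_iff
      matrix_matrix_mult_def vec_eq_iff sum.distrib sum_distrib_left algebra_simps)

section \<open>The hat map and skew parts\<close>

lemma bounded_linear_hat: "bounded_linear hat"
  by (simp add: linear_conv_bounded_linear[symmetric] linear_iff hat_def vec_eq_iff forall_3
      algebra_simps)

lemma transpose_hat: "transpose (hat x) = - hat x"
  by (simp add: hat_def transpose_def vec_eq_iff forall_3)

text \<open>Right multiplication by a skew matrix is skew-adjoint, so this number equals its own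
  negative. It removes the angular velocity from the derivative of the energy.\<close>

lemma inner_mult_hat_self: "M \<bullet> (M ** hat w) = 0"
proof -
  have "(M ** hat w) \<bullet> M = M \<bullet> (M ** (- hat w))"
    by (simp add: inner_matrix_mult_right transpose_hat)
  also have "\<dots> = - (M \<bullet> (M ** hat w))"
    by (simp add: bounded_bilinear.minus_right[OF bounded_bilinear_matrix_mult])
  finally show ?thesis
    by (simp add: inner_commute)
qed

lemma inner_hat_hat: "hat x \<bullet> hat y = 2 * (x \<bullet> y)"
  by (simp add: hat_def inner_vec_def sum_3)

lemma norm_hat: "norm (hat x) = sqrt 2 * norm x"
  by (simp add: norm_eq_sqrt_inner inner_hat_hat real_sqrt_mult)

text \<open>The symmetric part of \<open>M\<close> is orthogonal to every skew matrix; the 2 comes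
  from \<open>inner_hat_hat\<close>. This identity lets the bias update cancel the coupling term in
  the energy balance.\<close>

lemma inner_hat: "M \<bullet> hat x = 2 * (vee (Skew M) \<bullet> x)"
proof -
  have "M \<bullet> hat x = Skew M \<bullet> hat x"
    by (simp add: Skew_def hat_def transpose_def inner_vec_def sum_3 algebra_simps)
  also have "\<dots> = hat (vee (Skew M)) \<bullet> hat x"
    by (simp add: hat_vee Skew_in_so3)
  finally show ?thesis
    by (simp only: inner_hat_hat)
qed

lemma norm_transpose: "norm (transpose M) = norm (M :: real^'n^'m)"
  by (simp add: norm_matrix_eq_frobenius trace_mul_sym[of M])

lemma norm_Skew_le: "norm (Skew M) \<le> norm (M :: real^'n^'n)"
  using norm_triangle_ineq4[of M "transpose M"] by (simp add: Skew_def norm_transpose)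

text \<open>As an inverse, \<open>vee\<close> is controlled only on \<open>so3\<close>, so both
  sides are compared after applying the injective map \<open>hat\<close>.\<close>

lemma vee_Skew_minus: "vee (Skew (- M)) = - vee (Skew M)"
proof -
  have "hat (vee (Skew (- M))) = hat (- vee (Skew M))"
    by (simp add: hat_vee Skew_in_so3 linear_neg[OF bounded_linear.linear[OF bounded_linear_hat]])
       (simp add: Skew_def transpose_def vec_eq_iff field_simps)
  then show ?thesis
    by (rule injD[OF inj_hat])
qed

lemma matrix_inv_inverse:
  assumes "invertible (A :: real^'n^'n)"
  shows "A ** matrix_inv A = mat 1" "matrix_inv A ** A = mat 1"
proof -
  have "A ** matrix_inv A = mat 1 \<and> matrix_inv A ** A = mat 1"
    using assms unfolding invertible_def matrix_inv_def by (rule someI_ex)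
  then show "A ** matrix_inv A = mat 1" "matrix_inv A ** A = mat 1"
    by simp_all
qed

section \<open>A differential inequality on the half-line\<close>

text \<open>Integrating factor: the product \<open>W\<close> of \<open>V\<close> with
  \<open>exp (c * t)\<close> has nonpositive derivative and is therefore nonincreasing.\<close>

lemma exponential_decay_of_derivative_le:
  fixes V V' :: "real \<Rightarrow> real"
  assumes deriv: "\<And>t. t \<ge> 0 \<Longrightarrow> (V has_real_derivative V' t) (at t within {0..})"
    and le: "\<And>t. t \<ge> 0 \<Longrightarrow> V' t \<le> - c * V t"
    and "t \<ge> 0"
  shows "V t \<le> V 0 * exp (- c * t)"
proof -
  define W where "W = (\<lambda>t. V t * exp (c * t))"
  have W: "(W has_real_derivative ((V' s + c * V s) * exp (c * s))) (at s within {0..})"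
    if "s \<ge> 0" for s
    unfolding W_def
    by (rule derivative_eq_intros deriv that refl | simp add: algebra_simps)+
  have "W t \<le> W 0"
  \<comment> \<open>At 0 the hypothesis gives only a one-sided derivative, so two-sided derivatives
    are used in the interior and continuity at the endpoints.\<close>
  proof (rule DERIV_nonpos_imp_decreasing_open[OF \<open>t \<ge> 0\<close>])
    fix s :: real assume s: "0 < s" "s < t"
    have "at s within {0..} = at s"
      using s by (intro at_within_interior) simp
    moreover have "(V' s + c * V s) * exp (c * s) \<le> 0"
      using le[of s] s by (intro mult_nonpos_nonneg) auto
    ultimately show "\<exists>y. DERIV W s :> y \<and> y \<le> 0"
      using W[of s] s by auto
  next
    have "continuous_on {0..} W"
      using W by (auto intro!: DERIV_continuous_on)
    then show "continuous_on {0..t} W"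
      by (rule continuous_on_subset) auto
  qed
  then show ?thesis
    by (simp add: W_def exp_minus field_simps)
qed

section \<open>Exponential stability of the error system\<close>

text \<open>The velocity argument is the one driving \<open>E\<close>, later the measured
  \<open>\<Omega>\<^sub>m\<close>; \<open>p\<close> and \<open>q\<close> stand for
  \<open>k\<^sub>P\<close> and \<open>k\<^sub>I\<close>. The products nest to the right so that
  \<open>R\<close> and \<open>F\<close> can be moved across the inner product one at a time.\<close>

definition error_solution ::
  "(real \<Rightarrow> real^3^3) \<Rightarrow> (real \<Rightarrow> real^3) \<Rightarrow> real^3^3 \<Rightarrow> real \<Rightarrow> real
    \<Rightarrow> (real \<Rightarrow> real^3^3) \<Rightarrow> (real \<Rightarrow> real^3) \<Rightarrow> bool" where
  "error_solution R \<Omega> F p q E e \<longleftrightarrow>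
    (\<forall>t\<ge>0. (E has_vector_derivative
        E t ** hat (\<Omega> t) - R t ** hat (e t) - p *\<^sub>R E t) (at t within {0..})) \<and>
    (\<forall>t\<ge>0. (e has_vector_derivative
        q *\<^sub>R vee (Skew (transpose (R t) ** (transpose F ** (F ** E t))))) (at t within {0..}))"

text \<open>Two velocities occur: \<open>\<Omega>\<close> enters through the derivative of
  \<open>R\<close> inside the cross term, \<open>\<Omega>'\<close> through the equation for
  \<open>E\<close>. Only their bounds enter the constants, which makes \<open>a\<close> and
  \<open>C\<close> uniform over all solutions.\<close>

lemma error_system_exponentially_stable:
  fixes R :: "real \<Rightarrow> real^3^3" and \<Omega> \<Omega>' :: "real \<Rightarrow> real^3" and F :: "real^3^3" and p q :: real
  assumes SO3: "\<And>t. t \<ge> 0 \<Longrightarrow> R t \<in> SO3"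
    and kin: "\<And>t. t \<ge> 0 \<Longrightarrow> (R has_vector_derivative R t ** hat (\<Omega> t)) (at t within {0..})"
    and bdd: "bounded (\<Omega> ` {0..})" "bounded (\<Omega>' ` {0..})"
    and F: "invertible F" and p: "p > 0" and q: "q > 0"
  shows "\<exists>a>0. \<exists>C>0. \<forall>E e t. error_solution R \<Omega>' F p q E e \<longrightarrow> t \<ge> 0 \<longrightarrow>
      norm (E t) + norm (e t) \<le> C * (norm (E 0) + norm (e 0)) * exp (- a * t)"
proof -
  interpret mm: bounded_bilinear "(**) :: real^3^3 \<Rightarrow> real^3^3 \<Rightarrow> real^3^3"
    by (rule bounded_bilinear_matrix_mult)
  obtain K where "K > 0" "\<forall>(M :: real^3^3) (N :: real^3^3). norm (M ** N) \<le> norm M * norm N * K"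
    using mm.pos_bounded by blast
  then have K: "K > 0" "norm (M ** N) \<le> K * norm M * norm N" for M N :: "real^3^3"
    by (auto simp: mult.assoc mult.commute[of K])
  obtain B where B: "B > 0" "\<And>t. t \<ge> 0 \<Longrightarrow> norm (\<Omega> t) \<le> B"
    using bdd(1) unfolding bounded_pos by auto
  obtain B' where B': "B' > 0" "\<And>t. t \<ge> 0 \<Longrightarrow> norm (\<Omega>' t) \<le> B'"
    using bdd(2) unfolding bounded_pos by auto
  \<comment> \<open>\<open>L\<close> converts decay of \<open>F ** E\<close> into decay of
    \<open>E\<close>; the added 1 makes its positivity immediate.\<close>
  define L where "L = K * norm (matrix_inv F) + 1"
  have L: "L > 0" "norm M \<le> L * norm (F ** M)" for M :: "real^3^3"
  proof -
    show "L > 0"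
      using K(1) by (simp add: L_def add_nonneg_pos)
    have "norm M = norm (matrix_inv F ** (F ** M))"
      by (simp add: matrix_mul_assoc matrix_inv_inverse F)
    also have "\<dots> \<le> K * norm (matrix_inv F) * norm (F ** M)"
      by (rule K)
    also have "\<dots> \<le> L * norm (F ** M)"
      by (simp add: L_def distrib_right)
    finally show "norm M \<le> L * norm (F ** M)" .
  qed
  \<comment> \<open>With x and y the norms of \<open>E\<close> and \<open>e\<close>, the derivative
    of \<open>E \<bullet> G\<close> (where \<open>G\<close> is \<open>R ** hat e\<close>) will be at
    most c2 x^2 + c1 x y - 2 y^2. Young's inequality trades c1 x y for (c1^2/4) x^2 + y^2, which
    gives \<open>k\<close>.\<close>
  define c1 where "c1 = 2 * K * B' + 2 * K * B + p * sqrt 2"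
  define c2 where "c2 = q * (K * norm F)^2"
  define k where "k = c1^2 / 4 + c2"
  have k: "k \<ge> 0"
    using q by (simp add: k_def c2_def)
  \<comment> \<open>Here \<open>\<alpha>\<close> is the dissipation rate in x^2 and
    \<open>\<mu>\<close> the coercivity constant of the energy without cross term. The two bounds on
    \<open>\<epsilon>\<close> let the cross term cost at most half of each. Then V' is at most
    -\<open>\<nu>\<close> Q and V at most \<open>U\<close> Q, where Q = x^2 + y^2.\<close>
  define \<alpha> where "\<alpha> = p / L^2"
  define \<mu> where "\<mu> = min (1 / (2 * L^2)) (1 / q)"
  define \<epsilon> where "\<epsilon> = min (\<mu> / 2) (\<alpha> / (2 * (k + 1)))"
  define \<nu> where "\<nu> = min (\<alpha> / 2) \<epsilon>"
  define U where "U = (K * norm F)^2 / 2 + 1 / q + \<epsilon>"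
  have pos: "\<alpha> > 0" "\<mu> > 0"
    using p q L by (auto simp: \<alpha>_def \<mu>_def)
  then have \<epsilon>: "\<epsilon> > 0"
    using k by (simp add: \<epsilon>_def)
  with pos have \<nu>: "\<nu> > 0"
    by (simp add: \<nu>_def)
  have U: "U > 0"
    using q \<epsilon> by (simp add: U_def add_nonneg_pos add_pos_pos)
  have \<epsilon>_le: "\<epsilon> \<le> \<mu> / 2"
    unfolding \<epsilon>_def by (rule min.cobounded1)
  have "\<epsilon> \<le> \<alpha> / (2 * (k + 1))"
    unfolding \<epsilon>_def by (rule min.cobounded2)
  then have "\<epsilon> * (k + 1) \<le> \<alpha> / 2"
    using k by (simp add: field_simps)
  then have \<epsilon>k: "\<epsilon> * k \<le> \<alpha> / 2"
    using \<epsilon> by (simp add: algebra_simps)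
  show ?thesis
  \<comment> \<open>The quadratic function \<open>V\<close> decays at rate \<open>\<nu> / U\<close>;
    norms scale like its square root, hence half that rate.\<close>
  proof (rule exI[of _ "\<nu> / U / 2"], intro conjI, goal_cases)
    case 1 show ?case using \<nu> U by simp
  next
    case 2
    show ?case
    \<comment> \<open>Under the root, 2 \<open>U\<close> / \<open>\<mu>\<close> is the ratio of the
      upper to the lower bound on \<open>V\<close>, and another 2 comes from (x + y)^2 \<le> 2 (x^2
      + y^2).\<close>
    proof (rule exI[of _ "sqrt (4 * U / \<mu>)"], intro conjI allI impI, goal_cases)
      case 1 show ?case using U pos by simp
    next
      case (2 E e T)
      have E: "(E has_vector_derivative
          E t ** hat (\<Omega>' t) - R t ** hat (e t) - p *\<^sub>R E t) (at t within {0..})"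
        and e: "(e has_vector_derivative
          q *\<^sub>R vee (Skew (transpose (R t) ** (transpose F ** (F ** E t))))) (at t within {0..})"
        if "t \<ge> 0" for t
        using 2(1) that unfolding error_solution_def by auto
      define v where "v = (\<lambda>t. vee (Skew (transpose (R t) ** (transpose F ** (F ** E t)))))"
      define D where "D = (\<lambda>t. E t ** hat (\<Omega>' t) - R t ** hat (e t) - p *\<^sub>R E t)"
      define G where "G = (\<lambda>t. R t ** hat (e t))"
      define G' where "G' = (\<lambda>t. R t ** (q *\<^sub>R hat (v t)) + (R t ** hat (\<Omega> t)) ** hat (e t))"
      define V where "V = (\<lambda>t. (F ** E t) \<bullet> (F ** E t) / 2 + (e t \<bullet> e t) / q + \<epsilon> * (E t \<bullet> G t))"
      define V' where "V' = (\<lambda>t. (F ** E t) \<bullet> (F ** D t) + 2 * (e t \<bullet> v t)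
          + \<epsilon> * (E t \<bullet> G' t + D t \<bullet> G t))"
      define Q where "Q = (\<lambda>t. (norm (E t))^2 + (norm (e t))^2)"
      have dE: "(E has_vector_derivative D t) (at t within {0..})" if "t \<ge> 0" for t
        unfolding D_def using E that by simp
      have de: "(e has_vector_derivative q *\<^sub>R v t) (at t within {0..})" if "t \<ge> 0" for t
        unfolding v_def using e that by simp
      have dh: "((\<lambda>t. hat (e t)) has_vector_derivative q *\<^sub>R hat (v t)) (at t within {0..})"
        if "t \<ge> 0" for t
        using bounded_linear.has_vector_derivative[OF bounded_linear_hat de[OF that]]
        by (simp add: linear_cmul[OF bounded_linear.linear[OF bounded_linear_hat]])
      have dG: "(G has_vector_derivative G' t) (at t within {0..})" if "t \<ge> 0" for t
        unfolding G_def G'_def by (rule mm.has_vector_derivative[OF kin dh]) (use that in auto)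
      have dV: "(V has_real_derivative V' t) (at t within {0..})" if "t \<ge> 0" for t
      proof -
        note dFE = bounded_linear.has_vector_derivative[OF mm.bounded_linear_right dE[OF that], of F]
        note dip = bounded_bilinear.has_vector_derivative[OF bounded_bilinear_inner]
        note d1 = dip[OF dFE dFE, folded has_real_derivative_iff_has_vector_derivative]
        note d2 = dip[OF de[OF that] de[OF that], folded has_real_derivative_iff_has_vector_derivative]
        note d3 = dip[OF dE[OF that] dG[OF that], folded has_real_derivative_iff_has_vector_derivative]
        have "(V has_real_derivative
            ((F ** E t) \<bullet> (F ** D t) + (F ** D t) \<bullet> (F ** E t)) / 2
            + (e t \<bullet> (q *\<^sub>R v t) + (q *\<^sub>R v t) \<bullet> e t) / q
            + \<epsilon> * (E t \<bullet> G' t + D t \<bullet> G t)) (at t within {0..})"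
          unfolding V_def by (intro DERIV_add DERIV_cdivide DERIV_cmult d1 d2 d3)
        moreover have "((F ** E t) \<bullet> (F ** D t) + (F ** D t) \<bullet> (F ** E t)) / 2
            = (F ** E t) \<bullet> (F ** D t)"
          by (simp add: inner_commute)
        moreover have "(e t \<bullet> (q *\<^sub>R v t) + (q *\<^sub>R v t) \<bullet> e t) / q = 2 * (e t \<bullet> v t)"
          using q by (simp add: inner_commute)
        ultimately show ?thesis
          unfolding V'_def by simp
      qed
      have nG: "norm (G t) = sqrt 2 * norm (e t)" if "t \<ge> 0" for t
        using SO3[OF that] by (simp add: G_def SO3_def norm_orthogonal_mult norm_hat)
      have cross: "\<bar>\<epsilon> * (E t \<bullet> G t)\<bar> \<le> \<epsilon> * Q t" if "t \<ge> 0" for t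
      proof -
        have "\<bar>E t \<bullet> G t\<bar> \<le> norm (E t) * (sqrt 2 * norm (e t))"
          using Cauchy_Schwarz_ineq2[of "E t" "G t"] nG[OF that] by simp
        also have "\<dots> \<le> norm (E t) * (2 * norm (e t))"
          using sqrt2_less_2 by (intro mult_left_mono mult_right_mono) auto
        also have "\<dots> \<le> Q t"
          using sum_squares_bound[of "norm (E t)" "norm (e t)"] by (simp add: Q_def)
        finally show ?thesis
          using \<epsilon> by (simp add: abs_mult)
      qed
      have lower: "\<mu> / 2 * Q t \<le> V t" if "t \<ge> 0" for t
      proof -
        have "(norm (E t))^2 \<le> (L * norm (F ** E t))^2"
          using L by (intro power_mono) auto
        then have "1 / (2 * L^2) * (norm (E t))^2 \<le> (norm (F ** E t))^2 / 2"
          using L by (simp add: field_simps power_mult_distrib)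
        moreover have "\<mu> * (norm (E t))^2 \<le> 1 / (2 * L^2) * (norm (E t))^2"
          by (intro mult_right_mono) (auto simp: \<mu>_def)
        moreover have "\<mu> * (norm (e t))^2 \<le> 1 / q * (norm (e t))^2"
          by (intro mult_right_mono) (auto simp: \<mu>_def)
        moreover have "\<epsilon> * Q t \<le> \<mu> / 2 * Q t"
          using \<epsilon>_le by (intro mult_right_mono) (auto simp: Q_def)
        ultimately show ?thesis
          using cross[OF that] unfolding V_def Q_def
          by (simp add: power2_norm_eq_inner[symmetric] algebra_simps abs_le_iff)
      qed
      have upper: "V t \<le> U * Q t" if "t \<ge> 0" for t
      proof -
        have "(norm (F ** E t))^2 \<le> (K * norm F * norm (E t))^2"
          using K by (intro power_mono) auto
        then have "(norm (F ** E t))^2 / 2 \<le> (K * norm F)^2 / 2 * (norm (E t))^2"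
          by (simp add: power_mult_distrib)
        moreover have "0 \<le> (K * norm F)^2 / 2 * (norm (e t))^2 + 1 / q * (norm (E t))^2"
          using q by simp
        moreover have "U * Q t = (K * norm F)^2 / 2 * (norm (E t))^2 + 1 / q * (norm (e t))^2 + \<epsilon> * Q t
            + ((K * norm F)^2 / 2 * (norm (e t))^2 + 1 / q * (norm (E t))^2)"
          by (simp add: U_def Q_def algebra_simps)
        moreover have "V t = (norm (F ** E t))^2 / 2 + 1 / q * (norm (e t))^2 + \<epsilon> * (E t \<bullet> G t)"
          by (simp add: V_def power2_norm_eq_inner)
        ultimately show ?thesis
          using cross[OF that] by linarith
      qed
      have decay: "V' t \<le> - \<nu> * Q t" if "t \<ge> 0" for t
      proof -
        define x y where "x = norm (E t)" and "y = norm (e t)"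
        have xy: "x \<ge> 0" "y \<ge> 0"
          by (auto simp: x_def y_def)
        have Rt: "transpose (R t) ** R t = mat 1" "R t ** transpose (R t) = mat 1"
          using SO3[OF that] by (auto simp: SO3_def matrix_left_right_inverse)
        \<comment> \<open>The rotation term vanishes by skewness, and the coupling through
          \<open>G\<close> cancels against the bias term. The weights 1/2 and 1/\<open>q\<close> in
          \<open>V\<close> are chosen for this cancellation.\<close>
        have main: "(F ** E t) \<bullet> (F ** D t) + 2 * (e t \<bullet> v t) = - p * (norm (F ** E t))^2"
        proof -
          have "F ** D t = (F ** E t) ** hat (\<Omega>' t) - F ** G t - p *\<^sub>R (F ** E t)"
            by (simp add: D_def G_def mm.diff_right mm.scaleR_right matrix_mul_assoc)
          moreover have "(F ** E t) \<bullet> (F ** G t) = 2 * (e t \<bullet> v t)"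
          proof -
            have "(F ** E t) \<bullet> (F ** G t) = (F ** (R t ** hat (e t))) \<bullet> (F ** E t)"
              by (simp add: G_def inner_commute)
            also have "\<dots> = hat (e t) \<bullet> (transpose (R t) ** (transpose F ** (F ** E t)))"
              by (simp add: inner_matrix_mult_left)
            also have "\<dots> = 2 * (e t \<bullet> v t)"
              by (simp only: inner_commute[of "hat _"] inner_hat v_def inner_commute[of "e t"])
            finally show ?thesis .
          qed
          ultimately show ?thesis
            by (simp add: inner_diff_right inner_mult_hat_self power2_norm_eq_inner)
        qed
        have "x^2 \<le> (L * norm (F ** E t))^2"
          unfolding x_def using L by (intro power_mono) auto
        then have "\<alpha> * x^2 \<le> p * (norm (F ** E t))^2"
          using L p by (simp add: \<alpha>_def field_simps power_mult_distrib)
        with main have m: "(F ** E t) \<bullet> (F ** D t) + 2 * (e t \<bullet> v t) \<le> - \<alpha> * x^2"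
          by simp
        have "E t \<bullet> G' t \<le> c2 * x^2 + 2 * K * B * x * y"
        proof -
          \<comment> \<open>Since \<open>hat (v t)\<close> is a skew part, its norm is at most that
            of the full matrix, from which the orthogonal factor then drops out.\<close>
          have "norm (hat (v t)) \<le> norm (transpose (R t) ** (transpose F ** (F ** E t)))"
            unfolding v_def by (simp add: hat_vee Skew_in_so3 norm_Skew_le)
          also have "\<dots> = norm (transpose F ** (F ** E t))"
            using Rt by (simp add: norm_orthogonal_mult)
          also have "\<dots> \<le> K * norm F * norm (F ** E t)"
            using K(2)[of "transpose F" "F ** E t"] by (simp add: norm_transpose)
          also have "\<dots> \<le> K * norm F * (K * norm F * x)"
            unfolding x_def using K by (intro mult_left_mono) auto
          finally have hv: "norm (hat (v t)) \<le> (K * norm F)^2 * x"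
            by (simp add: power2_eq_square mult_ac)
          have "norm (hat (\<Omega> t) ** hat (e t)) \<le> K * norm (hat (\<Omega> t)) * norm (hat (e t))"
            by (rule K)
          also have "\<dots> = 2 * (K * norm (\<Omega> t) * y)"
            by (simp add: norm_hat y_def)
          also have "\<dots> \<le> 2 * (K * B * y)"
            using K(1) B(2)[OF that] xy by (intro mult_left_mono mult_right_mono) auto
          finally have hh: "norm (hat (\<Omega> t) ** hat (e t)) \<le> 2 * (K * B * y)" .
          \<comment> \<open>Factoring out the rotation leaves the norm unchanged, so only
            \<open>hv\<close> and \<open>hh\<close> are needed.\<close>
          have "G' t = R t ** (q *\<^sub>R hat (v t) + hat (\<Omega> t) ** hat (e t))"
            by (simp add: G'_def mm.add_right matrix_mul_assoc)
          then have "norm (G' t) = norm (q *\<^sub>R hat (v t) + hat (\<Omega> t) ** hat (e t))"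
            using Rt by (simp add: norm_orthogonal_mult)
          also have "\<dots> \<le> q * norm (hat (v t)) + norm (hat (\<Omega> t) ** hat (e t))"
            using q by (intro order_trans[OF norm_triangle_ineq]) simp
          also have "\<dots> \<le> q * ((K * norm F)^2 * x) + 2 * (K * B * y)"
            using hv hh q by (intro add_mono mult_left_mono) auto
          finally have "norm (G' t) \<le> c2 * x + 2 * K * B * y"
            by (simp add: c2_def mult_ac)
          then have "x * norm (G' t) \<le> x * (c2 * x + 2 * K * B * y)"
            using xy by (intro mult_left_mono) auto
          moreover have "E t \<bullet> G' t \<le> x * norm (G' t)"
            unfolding x_def by (rule norm_cauchy_schwarz)
          ultimately show ?thesis
            by (simp add: algebra_simps power2_eq_square)
        qed
        \<comment> \<open>The term - 2 y^2 comes from -\<open>G t \<bullet> G t\<close> and is the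
          dissipation in \<open>e\<close> that the energy alone lacks.\<close>
        moreover have "D t \<bullet> G t \<le> (2 * K * B' + p * sqrt 2) * x * y - 2 * y^2"
        proof -
          have "(E t ** hat (\<Omega>' t)) \<bullet> G t \<le> norm (E t ** hat (\<Omega>' t)) * (sqrt 2 * y)"
            using norm_cauchy_schwarz[of "E t ** hat (\<Omega>' t)" "G t"] nG[OF that] by (simp add: y_def)
          also have "\<dots> \<le> (K * x * (sqrt 2 * B')) * (sqrt 2 * y)"
          proof (rule mult_right_mono)
            have "norm (E t ** hat (\<Omega>' t)) \<le> K * x * (sqrt 2 * norm (\<Omega>' t))"
              using K(2)[of "E t" "hat (\<Omega>' t)"] by (simp add: x_def norm_hat)
            also have "\<dots> \<le> K * x * (sqrt 2 * B')"
              using K(1) B'(2)[OF that] xy by (intro mult_left_mono) auto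
            finally show "norm (E t ** hat (\<Omega>' t)) \<le> K * x * (sqrt 2 * B')" .
          qed (use xy in auto)
          also have "\<dots> = (sqrt 2 * sqrt 2) * (K * B' * x * y)"
            by (simp only: mult_ac)
          finally have 1: "(E t ** hat (\<Omega>' t)) \<bullet> G t \<le> 2 * K * B' * x * y"
            by simp
          have 2: "G t \<bullet> G t = 2 * y^2"
            using nG[OF that] by (simp add: power2_norm_eq_inner[symmetric] y_def power_mult_distrib)
          have "- (E t \<bullet> G t) \<le> x * (sqrt 2 * y)"
            using Cauchy_Schwarz_ineq2[of "E t" "G t"] nG[OF that] by (simp add: x_def y_def)
          then have "p * (- (E t \<bullet> G t)) \<le> p * (x * (sqrt 2 * y))"
            using p by (intro mult_left_mono) auto
          moreover have "D t \<bullet> G t = (E t ** hat (\<Omega>' t)) \<bullet> G t - G t \<bullet> G t + p * (- (E t \<bullet> G t))"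
            by (simp add: D_def G_def inner_diff_left)
          ultimately show ?thesis
            using 1 2 by (simp add: algebra_simps)
        qed
        ultimately have "E t \<bullet> G' t + D t \<bullet> G t \<le> c2 * x^2 + c1 * x * y - 2 * y^2"
          by (simp add: c1_def algebra_simps)
        \<comment> \<open>Young's inequality spends one of the two available y^2.\<close>
        also have "\<dots> \<le> k * x^2 - y^2"
          using sum_squares_bound[of "c1 / 2 * x" y]
          by (simp add: k_def power_mult_distrib power_divide algebra_simps)
        finally have "\<epsilon> * (E t \<bullet> G' t + D t \<bullet> G t) \<le> \<epsilon> * (k * x^2 - y^2)"
          using \<epsilon> by (intro mult_left_mono) auto
        also have "\<dots> = (\<epsilon> * k) * x^2 - \<epsilon> * y^2"
          by (simp add: algebra_simps)
        also have "\<dots> \<le> \<alpha> / 2 * x^2 - \<epsilon> * y^2"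
          using \<epsilon>k by (intro diff_right_mono mult_right_mono) auto
        finally have "V' t \<le> - (\<alpha> / 2 * x^2) - \<epsilon> * y^2"
          unfolding V'_def using m by simp
        moreover have "\<nu> * x^2 \<le> \<alpha> / 2 * x^2" "\<nu> * y^2 \<le> \<epsilon> * y^2"
          unfolding \<nu>_def by (rule mult_right_mono; simp)+
        ultimately show ?thesis
          by (simp add: Q_def x_def y_def algebra_simps)
      qed
      have "V T \<le> V 0 * exp (- (\<nu> / U) * T)"
      proof (rule exponential_decay_of_derivative_le[OF dV])
        fix t :: real assume t: "t \<ge> 0"
        have "\<nu> / U * V t \<le> \<nu> / U * (U * Q t)"
          using upper[OF t] \<nu> U by (intro mult_left_mono) auto
        with decay[OF t] show "V' t \<le> - (\<nu> / U) * V t"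
          using U by simp
      qed (use 2(2) in auto)
      also have "\<dots> \<le> U * Q 0 * exp (- (\<nu> / U) * T)"
        using upper[of 0] by (intro mult_right_mono) auto
      finally have "\<mu> / 2 * Q T \<le> U * Q 0 * exp (- (\<nu> / U) * T)"
        using lower[of T] 2(2) by simp
      then have QT: "Q T \<le> 2 * U / \<mu> * Q 0 * exp (- (\<nu> / U) * T)"
        using pos by (simp add: field_simps)
      have "(norm (E T) + norm (e T))^2 \<le> 2 * Q T"
        using sum_squares_bound[of "norm (E T)" "norm (e T)"] by (simp add: Q_def power2_sum)
      also have "\<dots> \<le> 4 * U / \<mu> * exp (- (\<nu> / U) * T) * Q 0"
        using QT pos by (simp add: field_simps)
      also have "\<dots> \<le> 4 * U / \<mu> * exp (- (\<nu> / U) * T) * (norm (E 0) + norm (e 0))^2"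
        using U pos by (intro mult_left_mono) (auto simp: Q_def power2_sum)
      \<comment> \<open>Writing the bound as a square allows the root to be taken on both
        sides.\<close>
      also have "\<dots> = (sqrt (4 * U / \<mu>) * (norm (E 0) + norm (e 0)) * exp (- (\<nu> / U / 2) * T))^2"
        using U pos by (simp add: power_mult_distrib exp_double[symmetric])
      finally show ?case
        by (rule power2_le_imp_le) (use U pos in auto)
    qed
  qed
qed

section \<open>Reduction of the observer to the error system\<close>

theorem corollary2:
  fixes R :: "real \<Rightarrow> real^3^3" and \<Omega> \<Omega>\<^sub>m :: "real \<Rightarrow> real^3"
    and b :: "real^3" and F :: "real^3^3" and A :: "real \<Rightarrow> real^3^3"
    and k\<^sub>P k\<^sub>I :: real
  assumes R_SO3: "\<And>t. t \<ge> 0 \<Longrightarrow> R t \<in> SO3"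
    and kinematics:
      "\<And>t. t \<ge> 0 \<Longrightarrow> (R has_vector_derivative R t ** hat (\<Omega> t)) (at t within {0..})"
    and \<Omega>_bounded: "bounded (\<Omega> ` {0..})"
    and \<Omega>\<^sub>m: "\<And>t. t \<ge> 0 \<Longrightarrow> \<Omega>\<^sub>m t = \<Omega> t + b"
    and F: "invertible F"
    and A: "\<And>t. t \<ge> 0 \<Longrightarrow> A t = F ** R t"
    and k\<^sub>P: "k\<^sub>P > 0" and k\<^sub>I: "k\<^sub>I > 0"
  shows "\<exists>a>0. \<exists>C>0. \<forall>(A\<^sub>0 :: real^3^3) (b\<^sub>0 :: real^3).
    \<forall>(Abar :: real \<Rightarrow> real^3^3) (bbar :: real \<Rightarrow> real^3).
      Abar 0 = A\<^sub>0 \<and> bbar 0 = b\<^sub>0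
      \<and> (\<forall>t\<ge>0. (Abar has_vector_derivative
            (Abar t ** hat (\<Omega>\<^sub>m t) - A t ** hat (bbar t) + k\<^sub>P *\<^sub>R (A t - Abar t)))
            (at t within {0..}))
      \<and> (\<forall>t\<ge>0. (bbar has_vector_derivative
            k\<^sub>I *\<^sub>R vee (Skew (transpose (A t) ** Abar t))) (at t within {0..}))
      \<longrightarrow> (let E\<^sub>R = (\<lambda>t. R t - matrix_inv F ** Abar t); e\<^sub>b = (\<lambda>t. b - bbar t) in
            \<forall>t\<ge>0. norm (E\<^sub>R t) + norm (e\<^sub>b t)
                  \<le> C * (norm (E\<^sub>R 0) + norm (e\<^sub>b 0)) * exp (- a * t))"
proof -
  interpret mm: bounded_bilinear "(**) :: real^3^3 \<Rightarrow> real^3^3 \<Rightarrow> real^3^3"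
    by (rule bounded_bilinear_matrix_mult)
  have "bounded (\<Omega>\<^sub>m ` {0..})"
  proof -
    have "\<Omega>\<^sub>m ` {0..} = (\<lambda>x. b + x) ` (\<Omega> ` {0..})"
      unfolding image_image by (rule image_cong) (auto simp: \<Omega>\<^sub>m)
    then show ?thesis
      using bounded_translation[OF \<Omega>_bounded, of b] by simp
  qed
  from error_system_exponentially_stable[OF R_SO3 kinematics \<Omega>_bounded this F k\<^sub>P k\<^sub>I]
  obtain a C where "a > 0" "C > 0"
    and stable: "\<And>E e t. error_solution R \<Omega>\<^sub>m F k\<^sub>P k\<^sub>I E e \<Longrightarrow> t \<ge> 0 \<Longrightarrow>
      norm (E t) + norm (e t) \<le> C * (norm (E 0) + norm (e 0)) * exp (- a * t)"
    by blast
  have decay: "norm (R t - matrix_inv F ** Abar t) + norm (b - bbar t)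
      \<le> C * (norm (R 0 - matrix_inv F ** Abar 0) + norm (b - bbar 0)) * exp (- a * t)"
    if Abar: "\<forall>t\<ge>0. (Abar has_vector_derivative
            (Abar t ** hat (\<Omega>\<^sub>m t) - A t ** hat (bbar t) + k\<^sub>P *\<^sub>R (A t - Abar t)))
            (at t within {0..})"
      and bbar: "\<forall>t\<ge>0. (bbar has_vector_derivative
            k\<^sub>I *\<^sub>R vee (Skew (transpose (A t) ** Abar t))) (at t within {0..})"
      and "t \<ge> 0" for Abar :: "real \<Rightarrow> real^3^3" and bbar :: "real \<Rightarrow> real^3" and t
  proof (rule stable[OF _ \<open>t \<ge> 0\<close>], unfold error_solution_def, intro conjI allI impI)
    fix t :: real assume t: "t \<ge> 0"
    define E where "E = R t - matrix_inv F ** Abar t"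
    have FA: "matrix_inv F ** A t = R t"
      by (simp add: A t matrix_mul_assoc matrix_inv_inverse F)
    \<comment> \<open>Turns the correction term of the observer into linear damping of
      \<open>E\<close>.\<close>
    have FE: "F ** E = A t - Abar t"
      by (simp add: E_def A t mm.diff_right matrix_mul_assoc matrix_inv_inverse F)
    have hat_b: "hat (b - bbar t) = hat b - hat (bbar t)" "hat (\<Omega>\<^sub>m t) = hat (\<Omega> t) + hat b"
      by (simp_all add: linear_diff[OF bounded_linear.linear[OF bounded_linear_hat]] \<Omega>\<^sub>m t
          linear_add[OF bounded_linear.linear[OF bounded_linear_hat]])
    let ?A' = "Abar t ** hat (\<Omega>\<^sub>m t) - A t ** hat (bbar t) + k\<^sub>P *\<^sub>R (A t - Abar t)"
    have "((\<lambda>t. R t - matrix_inv F ** Abar t) has_vector_derivative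
        R t ** hat (\<Omega> t) - matrix_inv F ** ?A') (at t within {0..})"
      using Abar t by (intro has_vector_derivative_diff kinematics
          bounded_linear.has_vector_derivative[OF mm.bounded_linear_right]) auto
    moreover have "matrix_inv F ** ?A'
        = (matrix_inv F ** Abar t) ** hat (\<Omega>\<^sub>m t) - R t ** hat (bbar t) + k\<^sub>P *\<^sub>R E"
      unfolding FE[symmetric]
      by (simp add: mm.diff_right mm.add_right mm.scaleR_right matrix_mul_assoc matrix_inv_inverse F FA)
    \<comment> \<open>Rewriting \<open>hat (\<Omega> t)\<close> as
      \<open>hat (\<Omega>\<^sub>m t) - hat b\<close> gives \<open>R\<close> and the estimate the
      same velocity; the leftover \<open>hat b\<close> joins \<open>hat (bbar t)\<close> to form the
      bias error.\<close>
    then have "R t ** hat (\<Omega> t) - matrix_inv F ** ?A'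
        = E ** hat (\<Omega>\<^sub>m t) - R t ** hat (b - bbar t) - k\<^sub>P *\<^sub>R E"
      by (simp add: E_def mm.diff_left mm.diff_right mm.add_right hat_b)
    ultimately show "((\<lambda>t. R t - matrix_inv F ** Abar t) has_vector_derivative
        (R t - matrix_inv F ** Abar t) ** hat (\<Omega>\<^sub>m t) - R t ** hat (b - bbar t)
        - k\<^sub>P *\<^sub>R (R t - matrix_inv F ** Abar t)) (at t within {0..})"
      by (simp add: E_def)
    have "Skew (transpose (A t) ** Abar t) = Skew (- (transpose (A t) ** (F ** E)))"
    proof -
      \<comment> \<open>\<open>A\<^sup>T A\<close> is symmetric, so it drops out of the skew part.\<close>
      have "transpose (transpose (A t) ** A t) = transpose (A t) ** A t"
        by (simp add: matrix_transpose_mul)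
      moreover have "transpose (A t) ** (F ** E) = transpose (A t) ** A t - transpose (A t) ** Abar t"
        by (simp add: FE mm.diff_right)
      ultimately show ?thesis
        by (simp add: Skew_def transpose_def vec_eq_iff)
    qed
    also have "transpose (A t) ** (F ** E) = transpose (R t) ** (transpose F ** (F ** E))"
      by (simp add: A t matrix_transpose_mul matrix_mul_assoc)
    finally have "vee (Skew (transpose (A t) ** Abar t))
        = - vee (Skew (transpose (R t) ** (transpose F ** (F ** E))))"
      by (simp add: vee_Skew_minus)
    \<comment> \<open>The minus sign from differentiating \<open>b - bbar t\<close> cancels the one
      in the preceding identity.\<close>
    moreover have "((\<lambda>t. b - bbar t) has_vector_derivative
        0 - k\<^sub>I *\<^sub>R vee (Skew (transpose (A t) ** Abar t))) (at t within {0..})"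
      using bbar t by (intro has_vector_derivative_diff has_vector_derivative_const) auto
    ultimately show "((\<lambda>t. b - bbar t) has_vector_derivative
        k\<^sub>I *\<^sub>R vee (Skew (transpose (R t) ** (transpose F
          ** (F ** (R t - matrix_inv F ** Abar t)))))) (at t within {0..})"
      by (simp add: E_def)
  qed
  show ?thesis
    unfolding Let_def using \<open>a > 0\<close> \<open>C > 0\<close> decay by blast
qed

end
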